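(* Let $\mathcal{S}=\{s_1,s_2,\ldots,s_k\}$ be a finite set of $k$ distinct integers, let $\mathcal{S}^*=\mathcal{S}\setminus\{0\}$, and let $n\ge 1$ be an integer. Let $\mathcal{R}_n^*(\mathcal{S})$ be the set of polynomials $f(X)=a_nX^n+a_{n-1}X^{n-1}+\cdots+a_1X+a_0$ with $a_i\in\mathcal{S}$ for all $0\le i\le n$ and $a_0a_n\neq 0$ that are reducible over $\mathbb{Z}[X]$. Let $M$ be a positive integer such that $$s_i\not\equiv s_j \pmod{M}\quad\text{for all } i\neq j\quad (i,j=1,2,\ldots,k).$$ Then $$|\mathcal{R}_n^*(\mathcal{S})|\le 4(n-1)M^{n-2}\left(\sum_{a\in\mathcal{S}^*}d(a)\right)^2.$$
   Context: For a nonzero integer $a$ (positive or negative), $d(a)$ denotes the number of positive divisors of $a$. A polynomial $f\in\mathbb{Z}[X]$ is called reducible if $f=pq$ for some $p,q\in\mathbb{Z}[X]$ both of positive degree (a factorization that merely extracts a non-unit integer constant does not count). *)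

theory Defs
  imports Complex_Main "HOL-Computational_Algebra.Polynomial" "HOL-Number_Theory.Cong"
begin

definition num_divisors :: "int \<Rightarrow> nat" where
  "num_divisors a = card {e :: int. e > 0 \<and> e dvd a}"

text \<open>
  Not \<open>\<not> irreducible f\<close>: the library notion of irreducibility in \<open>\<int>[X]\<close> also
  counts the extraction of a non-unit integer constant as a proper factorization.
\<close>

definition reducible_poly :: "int poly \<Rightarrow> bool" where
  "reducible_poly f \<longleftrightarrow> (\<exists>p q. degree p > 0 \<and> degree q > 0 \<and> f = p * q)"

text \<open>
  The bound \<open>degree f \<le> n\<close> says that \<open>f\<close> has the form \<open>a\<^sub>n X\<^sup>n + \<dots> + a\<^sub>0\<close>; together with
  \<open>coeff f n \<noteq> 0\<close> it forces the degree to be exactly \<open>n\<close>.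
\<close>

definition reducible_polys :: "nat \<Rightarrow> int set \<Rightarrow> int poly set" where
  "reducible_polys n S =
     {f. degree f \<le> n \<and> (\<forall>i\<le>n. coeff f i \<in> S) \<and> coeff f 0 * coeff f n \<noteq> 0 \<and>
         reducible_poly f}"

text \<open>Hence \<open>card (reducible_polys n S)\<close> is the genuine number of elements.\<close>

lemma finite_reducible_polys:
  assumes "finite S"
  shows "finite (reducible_polys n S)"
proof -
  have "reducible_polys n S \<subseteq> Poly ` {xs. set xs \<subseteq> S \<and> length xs = Suc n}"
  proof
    fix f assume f: "f \<in> reducible_polys n S"
    then have "f = Poly (map (coeff f) [0..<Suc n])"
      by (intro poly_eqI)
        (auto simp: reducible_polys_def nth_default_def coeff_eq_0 simp del: upt_Suc)
    moreover have "set (map (coeff f) [0..<Suc n]) \<subseteq> S"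
      using f by (auto simp: reducible_polys_def simp del: upt_Suc)
    ultimately show "f \<in> Poly ` {xs. set xs \<subseteq> S \<and> length xs = Suc n}"
      by (intro image_eqI[of _ _ "map (coeff f) [0..<Suc n]"]) (simp_all del: upt_Suc)
  qed
  then show ?thesis
    by (rule finite_subset) (intro finite_imageI finite_lists_length_eq assms)
qed

end

(* A factorization f = p q with deg p = r, 1 <= r < n, is recorded by the pair of constant
   coefficients, the pair of leading coefficients and the residues mod M of the n - 2 remaining
   coefficients of p and q. This record determines f mod M, hence f, because the elements of S are
   distinct mod M. The first two pairs multiply to nonzero elements of S, which leaves at most
   2 * (sum of d(a)) choices for each of them. *)
theory Submission
  imports Defs
begin

definition factor_pairs :: "int set \<Rightarrow> (int \<times> int) set" where
  "factor_pairs A = {(u, v). u * v \<in> A}"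

lemma finite_divisors_int:
  fixes a :: int
  assumes "a \<noteq> 0"
  shows "finite {d. d dvd a}"
proof (rule finite_subset)
  show "{d. d dvd a} \<subseteq> {- \<bar>a\<bar>..\<bar>a\<bar>}"
  proof
    fix d assume "d \<in> {d. d dvd a}"
    then have "\<bar>d\<bar> \<le> \<bar>a\<bar>"
      using assms by (simp add: dvd_imp_le_int)
    then show "d \<in> {- \<bar>a\<bar>..\<bar>a\<bar>}"
      by (simp add: abs_le_iff)
  qed
qed simp

text \<open>Negation exchanges positive and negative divisors, and 0 is not a divisor because
  \<open>a\<close> is nonzero. The factor 2 for signs that arises here, squared at the end, is the 4
  of the bound.\<close>

lemma card_divisors_int:
  fixes a :: int
  assumes "a \<noteq> 0"
  shows "card {d. d dvd a} = 2 * num_divisors a"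
proof -
  let ?P = "{e. e > 0 \<and> e dvd a}"
  have split: "{d. d dvd a} = ?P \<union> uminus ` ?P"
  proof (intro set_eqI iffI)
    fix d assume "d \<in> {d. d dvd a}"
    then have "d \<noteq> 0" "d dvd a" using assms by auto
    then show "d \<in> ?P \<union> uminus ` ?P"
      by (cases "d > 0") (auto intro!: image_eqI[of _ _ "- d"])
  qed auto
  have fin: "finite ?P"
    using finite_divisors_int[OF assms] by simp
  have "card (?P \<union> uminus ` ?P) = card ?P + card (uminus ` ?P)"
    using fin by (intro card_Un_disjoint) auto
  also have "card (uminus ` ?P) = card ?P"
    by (simp add: card_image)
  finally show ?thesis
    unfolding split num_divisors_def by simp
qed

text \<open>For nonzero \<open>a\<close> the first factor determines the second, so ordered
  factorizations of \<open>a\<close> are counted by its divisors of either sign.\<close>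

lemma factor_pairs_singleton:
  assumes "a \<noteq> 0"
  shows "factor_pairs {a} = (\<lambda>d. (d, a div d)) ` {d. d dvd a}"
proof (intro set_eqI iffI)
  fix x assume "x \<in> factor_pairs {a}"
  then obtain u v where x: "x = (u, v)" "u * v = a"
    by (auto simp: factor_pairs_def)
  with assms have "v = a div u" "u dvd a"
    by auto
  with x show "x \<in> (\<lambda>d. (d, a div d)) ` {d. d dvd a}"
    by blast
qed (auto simp: factor_pairs_def)

lemma card_factor_pairs_singleton:
  assumes "a \<noteq> 0"
  shows "card (factor_pairs {a}) = 2 * num_divisors a"
  unfolding factor_pairs_singleton[OF assms]
  by (subst card_image) (auto simp: inj_on_def card_divisors_int[OF assms])

lemma finite_factor_pairs_singleton: "a \<noteq> 0 \<Longrightarrow> finite (factor_pairs {a})"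
  by (simp add: factor_pairs_singleton finite_divisors_int)

lemma factor_pairs_UN: "factor_pairs A = (\<Union>a\<in>A. factor_pairs {a})"
  by (auto simp: factor_pairs_def)

lemma finite_factor_pairs:
  assumes "finite A" "0 \<notin> A"
  shows "finite (factor_pairs A)"
proof (subst factor_pairs_UN, rule finite_UN_I)
  show "finite (factor_pairs {a})" if "a \<in> A" for a
    using that assms by (intro finite_factor_pairs_singleton) auto
qed (rule assms)

text \<open>A pair determines its product, so the fibres over distinct elements of \<open>A\<close>
  are disjoint and their sizes add up.\<close>

lemma card_factor_pairs:
  assumes "finite A" "0 \<notin> A"
  shows "card (factor_pairs A) = 2 * (\<Sum>a\<in>A. num_divisors a)"
proof -
  have nz: "a \<noteq> 0" if "a \<in> A" for a
    using that assms by auto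
  have "card (factor_pairs A) = (\<Sum>a\<in>A. card (factor_pairs {a}))"
  proof (subst factor_pairs_UN, rule card_UN_disjoint)
    show "\<forall>a\<in>A. finite (factor_pairs {a})"
      using nz finite_factor_pairs_singleton by blast
  qed (use assms in \<open>auto simp: factor_pairs_def\<close>)
  also have "\<dots> = (\<Sum>a\<in>A. 2 * num_divisors a)"
    using nz by (intro sum.cong) (auto simp: card_factor_pairs_singleton)
  finally show ?thesis
    by (simp add: sum_distrib_left)
qed

lemma cong_coeff_mult:
  fixes p q p' q' :: "int poly"
  assumes "\<And>i. [coeff p i = coeff p' i] (mod m)" "\<And>i. [coeff q i = coeff q' i] (mod m)"
  shows "[coeff (p * q) i = coeff (p' * q') i] (mod m)"
  unfolding coeff_mult by (intro cong_sum cong_mult assms)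

text \<open>Indices 0 and \<open>degree p\<close> are left out because the end coefficients will be
  recorded exactly. For positive degree the list has length \<open>degree p - 1\<close>.\<close>

definition inner_residues :: "int \<Rightarrow> int poly \<Rightarrow> int list" where
  "inner_residues m p = map (\<lambda>i. coeff p i mod m) [1..<degree p]"

text \<open>The residues settle the inner indices, the assumed equalities the two end ones, and
  beyond the common degree both coefficients are 0.\<close>

lemma cong_coeff_if_inner_residues_eq:
  assumes "degree p = degree q" "coeff p 0 = coeff q 0" "lead_coeff p = lead_coeff q"
    and "inner_residues m p = inner_residues m q"
  shows "[coeff p i = coeff q i] (mod m)"
proof -
  consider "i = 0" | "i = degree p" | "i > degree p" | "1 \<le> i" "i < degree p"
    by linarith
  then show ?thesis
  proof cases
    case 4
    then show ?thesis
      using assms(1,4) by (simp add: inner_residues_def cong_def)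
  qed (use assms in \<open>simp_all add: coeff_eq_0\<close>)
qed

text \<open>The degree of \<open>p\<close> tells where to cut the concatenated list. The degree of
  \<open>q\<close> is omitted: it is recovered from the degree \<open>n\<close> of the
  product.\<close>

definition factorization_code ::
    "int \<Rightarrow> int poly \<times> int poly \<Rightarrow> nat \<times> (int \<times> int) \<times> (int \<times> int) \<times> int list" where
  "factorization_code m = (\<lambda>(p, q).
     (degree p, (coeff p 0, coeff q 0), (lead_coeff p, lead_coeff q),
      inner_residues m p @ inner_residues m q))"

lemma cong_coeff_if_factorization_code_eq:
  assumes "factorization_code m (p, q) = factorization_code m (p', q')"
    and "degree q = degree q'"
  shows "[coeff (p * q) i = coeff (p' * q') i] (mod m)"
proof -
  \<comment> \<open>Equal degrees of \<open>p\<close> and \<open>p'\<close> give prefixes of equal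
    length, so the equation between concatenations splits.\<close>
  have "inner_residues m p = inner_residues m p'" "inner_residues m q = inner_residues m q'"
    using assms by (auto simp: factorization_code_def inner_residues_def)
  then show ?thesis
    using assms
    by (intro cong_coeff_mult cong_coeff_if_inner_residues_eq) (auto simp: factorization_code_def)
qed

lemma obtain_factorization:
  assumes "f \<in> reducible_polys n S"
  obtains p q where "f = p * q" "degree p > 0" "degree q > 0" "degree p + degree q = n"
proof -
  obtain p q where pq: "degree p > 0" "degree q > 0" "f = p * q"
    using assms by (auto simp: reducible_polys_def reducible_poly_def)
  moreover have "degree f = n"
    using assms by (auto simp: reducible_polys_def intro: antisym le_degree)
  moreover have "degree (p * q) = degree p + degree q"
    using pq by (intro degree_mult_eq) auto
  ultimately show ?thesis
    using that by metis
qed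

text \<open>The end coefficients of \<open>p * q\<close> are the products of those of
  \<open>p\<close> and \<open>q\<close>, and they are nonzero elements of \<open>S\<close>. The two
  residue lists have total length \<open>(degree p - 1) + (degree q - 1) = n - 2\<close>.\<close>

lemma factorization_code_in:
  assumes "p * q \<in> reducible_polys n S" "degree p > 0" "degree q > 0" "degree p + degree q = n"
    and "m > 0"
  shows "factorization_code m (p, q) \<in> {1..<n} \<times> factor_pairs (S - {0}) \<times> factor_pairs (S - {0}) \<times>
    {xs. set xs \<subseteq> {0..<m} \<and> length xs = n - 2}"
proof -
  have "coeff (p * q) 0 \<in> S - {0}" "coeff (p * q) n \<in> S - {0}"
    using assms(1) by (auto simp: reducible_polys_def)
  moreover have "coeff (p * q) n = lead_coeff p * lead_coeff q"
    using assms(4) coeff_mult_degree_sum[of p q] by simp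
  ultimately show ?thesis
    using assms(2-5)
    by (auto simp: factorization_code_def factor_pairs_def inner_residues_def coeff_mult_0
        simp del: upt_Suc)
qed

lemma card_reducible_polys_le:
  fixes S :: "int set" and n M :: nat
  assumes "finite S" "M > 0"
    and distinct_mod: "\<And>s t. s \<in> S \<Longrightarrow> t \<in> S \<Longrightarrow> s \<noteq> t \<Longrightarrow> \<not> [s = t] (mod int M)"
  shows "card (reducible_polys n S)
    \<le> (n - 1) * (2 * (\<Sum>a\<in>S - {0}. num_divisors a))\<^sup>2 * M ^ (n - 2)"
proof -
  let ?T = "factor_pairs (S - {0})"
  let ?L = "{xs. set xs \<subseteq> {0..<int M} \<and> length xs = n - 2}"
  define R where "R = reducible_polys n S"
  have "\<forall>f\<in>R. \<exists>h. f = fst h * snd h \<and> degree (fst h) > 0 \<and> degree (snd h) > 0 \<and>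
      degree (fst h) + degree (snd h) = n"
    unfolding R_def by (metis obtain_factorization fst_conv snd_conv)
  \<comment> \<open>A polynomial may factor in several ways; choosing one factorization for each
    makes its code a function of \<open>f\<close>.\<close>
  then obtain h where h: "f = fst (h f) * snd (h f)" "degree (fst (h f)) > 0"
      "degree (snd (h f)) > 0" "degree (fst (h f)) + degree (snd (h f)) = n" if "f \<in> R" for f
    by metis
  let ?c = "\<lambda>f. factorization_code (int M) (h f)"
  have "inj_on ?c R"
  proof (rule inj_onI)
    fix f g assume fg: "f \<in> R" "g \<in> R" and eq: "?c f = ?c g"
    have "degree (fst (h f)) = degree (fst (h g))"
      using eq by (simp add: factorization_code_def split_beta)
    then have "degree (snd (h f)) = degree (snd (h g))"
      using h(4)[OF fg(1)] h(4)[OF fg(2)] by linarith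
    with eq have cong: "[coeff f i = coeff g i] (mod int M)" for i
      using cong_coeff_if_factorization_code_eq[of "int M" "fst (h f)" "snd (h f)"
          "fst (h g)" "snd (h g)" i] h(1)[OF fg(1)] h(1)[OF fg(2)] by simp
    show "f = g"
    proof (rule poly_eqI)
      fix i
      show "coeff f i = coeff g i"
      proof (cases "i \<le> n")
        \<comment> \<open>Both coefficients lie in \<open>S\<close>, whose elements are pairwise
          incongruent, so their congruence mod \<open>M\<close> is an equality.\<close>
        case True
        then show ?thesis
          using fg cong[of i] distinct_mod by (auto simp: R_def reducible_polys_def)
      next
        case False
        then have "degree f < i" "degree g < i"
          using fg by (auto simp: R_def reducible_polys_def)
        then show ?thesis
          by (simp add: coeff_eq_0)
      qed
    qed
  qed
  moreover have "?c ` R \<subseteq> {1..<n} \<times> ?T \<times> ?T \<times> ?L"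
  proof (rule image_subsetI)
    fix f assume f: "f \<in> R"
    then have "fst (h f) * snd (h f) \<in> reducible_polys n S"
      using h(1)[OF f] by (simp add: R_def)
    from factorization_code_in[OF this h(2-4)[OF f], of "int M"] assms(2)
    show "?c f \<in> {1..<n} \<times> ?T \<times> ?T \<times> ?L" by simp
  qed
  moreover have "finite ({1..<n} \<times> ?T \<times> ?T \<times> ?L)"
    using assms(1) by (simp add: finite_factor_pairs finite_lists_length_eq)
  ultimately have "card R \<le> card ({1..<n} \<times> ?T \<times> ?T \<times> ?L)"
    by (rule card_inj_on_le)
  also have "\<dots> = (n - 1) * (card ?T)\<^sup>2 * M ^ (n - 2)"
    by (simp add: card_cartesian_product card_lists_length_eq power2_eq_square)
  also have "card ?T = 2 * (\<Sum>a\<in>S - {0}. num_divisors a)"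
    using assms(1) by (simp add: card_factor_pairs)
  finally show ?thesis
    by (simp add: R_def)
qed

theorem theorem2p1:
  fixes S :: "int set" and n M :: nat
  assumes "finite S"
    and "n \<ge> 1"
    and "M > 0"
    and "\<And>s t. s \<in> S \<Longrightarrow> t \<in> S \<Longrightarrow> s \<noteq> t \<Longrightarrow> \<not> [s = t] (mod int M)"
  shows "real (card (reducible_polys n S))
           \<le> 4 * (real n - 1) * real M powi (int n - 2)
               * (\<Sum>a\<in>S - {0}. real (num_divisors a))^2"
proof -
  let ?D = "\<Sum>a\<in>S - {0}. num_divisors a"
  have le: "card (reducible_polys n S) \<le> (n - 1) * (2 * ?D)\<^sup>2 * M ^ (n - 2)"
    using assms by (intro card_reducible_polys_le)
  show ?thesis
  \<comment> \<open>For \<open>n = 1\<close> the integer exponent is -1 while the truncated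
    \<open>n - 2\<close> is 0, so the powers need not agree; the factor \<open>n - 1\<close> makes
    both bounds 0. From \<open>n = 2\<close> on the exponents coincide.\<close>
  proof (cases "n = 1")
    case True
    then show ?thesis using le by simp
  next
    case False
    with assms(2) have pow: "real M powi (int n - 2) = real M ^ (n - 2)"
      by (simp add: power_int_def nat_diff_distrib)
    have "real (card (reducible_polys n S)) \<le> real ((n - 1) * (2 * ?D)\<^sup>2 * M ^ (n - 2))"
      using le by (simp only: of_nat_le_iff)
    also have "\<dots> = 4 * (real n - 1) * real M powi (int n - 2) * (\<Sum>a\<in>S - {0}. real (num_divisors a))^2"
      using assms(2) by (simp add: pow of_nat_diff power_mult_distrib)
    finally show ?thesis .
  qed
qed

end
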